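(* Let $q$ be a complex number with $|q|<1$ and let $a,b,m,n$ be nonnegative integers with $a\geq m+2$ and $b\geq n+2$. Then $$\zeta_q(a;m)\zeta_q(b;n)=\sum_{i=0}^{m}\sum_{k=n}^{m+n-i}\binom{k}{n}\binom{n+1}{i+k-m+1}\zeta_q(b,a;k,i)+\sum_{i=0}^{n}\sum_{k=m}^{m+n-i}\binom{k}{m}\binom{m+1}{i+k-n+1}\zeta_q(a,b;k,i)+\sum_{k=n}^{m+n}\binom{k}{n}\binom{n}{k-m}\zeta_q(a+b;k).$$
   Context: Binomial convention: $\binom{p}{q}=0$ if $p<q$ or $q<0$. $[n]_q=1+q+\cdots+q^{n-1}$. For a finite sequence $\alpha=(\alpha_1,\ldots,\alpha_r)\in\mathbb{N}^{r-1}\times\mathbb{P}$, $$\zeta_q(\alpha)=\sum_{1\leq n_1<\cdots<n_r}\frac{q^{n_1\alpha_1+\cdots+n_r\alpha_r}}{[n_1]_q^{\alpha_1}\cdots[n_r]_q^{\alpha_r}}$$ (a convergent series). For positive integers $s_1,\ldots,s_k$ and $I=(i_1,\ldots,i_k)\in\mathbb{N}^k$, $\zeta_q(s_1,\ldots,s_k;I)=\zeta_q(0^{i_1},s_1,\ldots,0^{i_k},s_k)$, where $0^i$ denotes $i$ zero entries. *)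

theory Defs
  imports "HOL-Analysis.Infinite_Sum"
begin

text \<open>Binomial coefficient with an integer lower index, so that differences such as
  $i + k - m + 1$ may be negative (and the coefficient is then zero) instead of being
  truncated.\<close>

definition binom :: "nat \<Rightarrow> int \<Rightarrow> nat" where
  "binom p r = (if int p < r \<or> r < 0 then 0 else p choose nat r)"

definition qnum :: "complex \<Rightarrow> nat \<Rightarrow> complex" where
  "qnum q n = (\<Sum>j<n. q ^ j)"

definition index_tuples :: "nat \<Rightarrow> nat list set" where
  "index_tuples r = {ns. length ns = r \<and> sorted_wrt (<) ns \<and> (\<forall>n \<in> set ns. 1 \<le> n)}"

text \<open>For $|q| < 1$ and positive last entry of the exponent list, the family is absolutely
  summable, so the unordered sum is the value of the multiple series. Outside this range
  \<^const>\<open>infsum\<close> may return its default value 0.\<close>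

definition zeta_q :: "complex \<Rightarrow> nat list \<Rightarrow> complex" where
  "zeta_q q \<alpha> =
     (\<Sum>\<^sub>\<infinity>ns\<in>index_tuples (length \<alpha>).
        q ^ (\<Sum>j<length \<alpha>. ns ! j * \<alpha> ! j) / (\<Prod>j<length \<alpha>. qnum q (ns ! j) ^ (\<alpha> ! j)))"

text \<open>$\zeta_q(s_1,\ldots,s_k; i_1,\ldots,i_k) = \zeta_q(0^{i_1}, s_1, \ldots, 0^{i_k}, s_k)$;
  both lists are meant to have the same length.\<close>

definition zeta_q_ind :: "complex \<Rightarrow> nat list \<Rightarrow> nat list \<Rightarrow> complex" where
  "zeta_q_ind q ss is = zeta_q q (concat (map2 (\<lambda>s i. replicate i 0 @ [s]) ss is))"

end

theory Submission
  imports Defs "HOL-Analysis.Summation_Tests"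
begin

text \<open>Grouping the index tuples of \<open>\<zeta>\<^sub>q(0\<^sup>m, a)\<close> by their last entry \<open>N\<close> gives
  \<open>\<Sum>\<^sub>N (N-1 choose m) g\<^sub>a(N)\<close> with \<open>g\<^sub>a(N) = (q\<^sup>N / [N]\<^sub>q)\<^sup>a\<close>; likewise
  \<open>\<zeta>\<^sub>q(0\<^sup>k, b, 0\<^sup>i, a)\<close> is the sum of
  \<open>(M-1 choose k) (N-M-1 choose i) g\<^sub>b(M) g\<^sub>a(N)\<close> over \<open>M < N\<close>. The product of two series of
  depth one splits into the parts \<open>M < N\<close>, \<open>N < M\<close> and \<open>M = N\<close>, and each part
  is expanded by Vandermonde's identity, using \<open>N - 1 = (N-M-1) + M\<close> off the diagonal.\<close>

section \<open>Binomial identities\<close>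

lemma binom_of_nat: "binom p (int r) = p choose r"
  by (simp add: binom_def binomial_eq_0)

text \<open>This turns the factor produced by Vandermonde's identity into the index pattern of the
  theorem. If \<open>j - t\<close> exceeds \<open>p\<close>, the integer index on the left is
  negative and both sides vanish.\<close>

lemma binom_symmetric:
  assumes "t \<le> j"
  shows "binom p (int t + int p - int j) = p choose (j - t)"
proof (cases "j - t \<le> p")
  case True
  have "int t + int p - int j = int (p - (j - t))"
    using True assms by simp
  then have "binom p (int t + int p - int j) = p choose (p - (j - t))"
    by (simp only: binom_of_nat)
  then show ?thesis
    using True by (simp add: binomial_symmetric[symmetric])
next
  case False
  then show ?thesis
    using assms by (simp add: binom_def binomial_eq_0)
qed

text \<open>Vandermonde expands \<open>(x - n + p) choose j\<close> into products
  \<open>((x - n) choose t) * (p choose (j - t))\<close>; trinomial revision then absorbs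
  \<open>x choose n\<close> and leaves \<open>x choose (t + n)\<close>, with
  \<open>k = t + n\<close>. The shift \<open>p\<close> stays free: \<open>p = n\<close> serves the
  diagonal, \<open>p = n + 1\<close> the off-diagonal part.\<close>

lemma choose_mult_choose_expand:
  fixes x n p j :: nat
  shows "((x - n + p) choose j) * (x choose n) =
    (\<Sum>k = n..j + n. binom k (int n) * binom p (int k - int n + int p - int j) * (x choose k))"
proof (cases "n \<le> x")
  case True
  have coeff: "binom (t + n) (int n) * binom p (int (t + n) - int n + int p - int j) * (x choose (t + n))
      = (x choose n) * (((x - n) choose t) * (p choose (j - t)))" if "t \<le> j" for t
  proof -
    have "(x choose (t + n)) * ((t + n) choose n) = (x choose n) * ((x - n) choose t)"
    proof (cases "t + n \<le> x")
      case le: True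
      show ?thesis
        using choose_mult[of n "t + n" x] le by simp
    next
      case False
      then show ?thesis using True by (simp add: binomial_eq_0)
    qed
    then show ?thesis
      using binom_symmetric[OF that, of p] by (simp add: binom_of_nat mult_ac)
  qed
  have "(\<Sum>k = n..j + n. binom k (int n) * binom p (int k - int n + int p - int j) * (x choose k))
      = (\<Sum>t = 0..j. binom (t + n) (int n) * binom p (int (t + n) - int n + int p - int j)
          * (x choose (t + n)))"
    using sum.shift_bounds_cl_nat_ivl[of
        "\<lambda>k. binom k (int n) * binom p (int k - int n + int p - int j) * (x choose k)" 0 n j]
    by simp
  also have "\<dots> = (\<Sum>t\<le>j. (x choose n) * (((x - n) choose t) * (p choose (j - t))))"
    using coeff by (intro sum.cong) auto
  also have "\<dots> = (x choose n) * ((x - n + p) choose j)"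
    by (simp add: sum_distrib_left[symmetric] vandermonde)
  finally show ?thesis by simp
next
  \<comment> \<open>Here \<open>x < n\<close>, so \<open>x choose k\<close> is 0 for every
    \<open>k \<ge> n\<close> and the truncated \<open>x - n\<close> does no harm.\<close>
  case False
  then show ?thesis
    by (intro trans[OF _ sum.neutral[symmetric]]) (auto simp: binomial_eq_0)
qed

text \<open>The case \<open>p = n\<close>, \<open>j = m\<close> of the expansion, in which
  \<open>x - n + p\<close> collapses to \<open>x\<close>.\<close>

lemma choose_mult_choose_diagonal:
  "(x choose m) * (x choose n) =
    (\<Sum>k = n..m + n. binom k (int n) * binom n (int k - int m) * (x choose k))"
proof (cases "n \<le> x")
  case True
  then show ?thesis
    using choose_mult_choose_expand[of x n n m] by simp
next
  case False
  then show ?thesis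
    by (intro trans[OF _ sum.neutral[symmetric]]) (auto simp: binomial_eq_0)
qed

text \<open>Two expansions in a row: Vandermonde on \<open>N - 1 = (N - M - 1) + M\<close>
  introduces \<open>i\<close>, then \<open>choose_mult_choose_expand\<close> with
  \<open>j = m - i\<close> treats \<open>(M choose (m - i)) * ((M - 1) choose n)\<close>.\<close>

lemma choose_mult_choose_offdiagonal:
  assumes "1 \<le> M" "M < N"
  shows "((N - 1) choose m) * ((M - 1) choose n) =
    (\<Sum>i = 0..m. \<Sum>k = n..m + n - i.
      binom k (int n) * binom (n + 1) (int i + int k - int m + 1)
        * (((M - 1) choose k) * ((N - M - 1) choose i)))"
proof -
  have inner: "(M choose (m - i)) * ((M - 1) choose n) =
      (\<Sum>k = n..m + n - i. binom k (int n) * binom (n + 1) (int i + int k - int m + 1)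
        * ((M - 1) choose k))" if "i \<le> m" for i
  proof (cases "n \<le> M - 1")
    case True
    \<comment> \<open>One factor has upper index \<open>M\<close>, the other \<open>M - 1\<close>.
      This offset forces the shift \<open>p = n + 1\<close> and is the source of both the
      \<open>n + 1\<close> and the final \<open>+ 1\<close> in the coefficient.\<close>
    then have "M - 1 - n + (n + 1) = M"
      using assms by simp
    then have "(M choose (m - i)) * ((M - 1) choose n) =
      (\<Sum>k = n..m - i + n. binom k (int n)
        * binom (n + 1) (int k - int n + int (n + 1) - int (m - i)) * ((M - 1) choose k))"
      using choose_mult_choose_expand[of "M - 1" n "n + 1" "m - i"] by simp
    then show ?thesis
      using that by (simp add: algebra_simps)
  next
    case False
    then show ?thesis
      by (intro trans[OF _ sum.neutral[symmetric]]) (auto simp: binomial_eq_0)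
  qed
  have "(N - 1) choose m = (\<Sum>i = 0..m. ((N - M - 1) choose i) * (M choose (m - i)))"
    using vandermonde[of "N - M - 1" M m] assms by (simp add: atMost_atLeast0)
  then have "((N - 1) choose m) * ((M - 1) choose n) =
      (\<Sum>i = 0..m. ((N - M - 1) choose i) * ((M choose (m - i)) * ((M - 1) choose n)))"
    by (simp only: sum_distrib_right mult.assoc)
  also have "\<dots> = (\<Sum>i = 0..m. \<Sum>k = n..m + n - i.
      binom k (int n) * binom (n + 1) (int i + int k - int m + 1)
        * (((M - 1) choose k) * ((N - M - 1) choose i)))"
  proof (rule sum.cong[OF refl])
    fix i assume "i \<in> {0..m}"
    then have "i \<le> m" by simp
    show "((N - M - 1) choose i) * ((M choose (m - i)) * ((M - 1) choose n)) =
        (\<Sum>k = n..m + n - i. binom k (int n) * binom (n + 1) (int i + int k - int m + 1)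
          * (((M - 1) choose k) * ((N - M - 1) choose i)))"
      unfolding inner[OF \<open>i \<le> m\<close>] sum_distrib_left by (rule sum.cong) (simp_all only: mult_ac)
  qed
  finally show ?thesis .
qed

section \<open>Strictly increasing lists\<close>

text \<open>Variables with exponent 0 contribute the factor 1 to \<open>zeta_q\<close>, so a block
  of them enters only through the number of such lists.\<close>

definition increasing_lists :: "nat \<Rightarrow> 'a::linorder set \<Rightarrow> 'a list set" where
  "increasing_lists k A = {xs. length xs = k \<and> sorted_wrt (<) xs \<and> set xs \<subseteq> A}"

text \<open>A finite set has exactly one strictly increasing enumeration, so counting these lists is
  counting \<open>k\<close>-subsets.\<close>

lemma bij_betw_set_increasing_lists:
  assumes "finite A"
  shows "bij_betw set (increasing_lists k A) {B. B \<subseteq> A \<and> card B = k}"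
proof (rule bij_betw_byWitness[where f' = sorted_list_of_set])
  have fin: "finite B" if "B \<subseteq> A" for B
    using assms that by (rule rev_finite_subset)
  show "\<forall>xs\<in>increasing_lists k A. sorted_list_of_set (set xs) = xs"
    by (auto simp: increasing_lists_def strict_sorted_iff sorted_list_of_set.idem_if_sorted_distinct)
  show "\<forall>B\<in>{B. B \<subseteq> A \<and> card B = k}. set (sorted_list_of_set B) = B"
    using fin by simp
  show "set ` increasing_lists k A \<subseteq> {B. B \<subseteq> A \<and> card B = k}"
    by (auto simp: increasing_lists_def strict_sorted_iff distinct_card)
  show "sorted_list_of_set ` {B. B \<subseteq> A \<and> card B = k} \<subseteq> increasing_lists k A"
    using fin by (auto simp: increasing_lists_def)
qed

lemma card_increasing_lists:
  "finite A \<Longrightarrow> card (increasing_lists k A) = card A choose k"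
  using bij_betw_same_card[OF bij_betw_set_increasing_lists, of A k] by (simp add: n_subsets)

lemma finite_increasing_lists: "finite A \<Longrightarrow> finite (increasing_lists k A)"
  using bij_betw_finite[OF bij_betw_set_increasing_lists, of A k] by simp

text \<open>Once the last entry \<open>N\<close> is fixed, the others form an arbitrary increasing
  list below it, so each fibre is finite and can be counted.\<close>

lemma bij_betw_index_tuples_1:
  "bij_betw (\<lambda>(N, xs). xs @ [N]) (SIGMA N:{1..}. increasing_lists m {1..<N})
    (index_tuples (Suc m))"
proof (rule bij_betw_byWitness[where f' = "\<lambda>ns. (last ns, butlast ns)"])
  show "(\<lambda>ns. (last ns, butlast ns)) ` index_tuples (Suc m)
      \<subseteq> (SIGMA N:{1..}. increasing_lists m {1..<N})"
  proof (clarsimp simp: index_tuples_def)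
    fix ns :: "nat list"
    assume ns: "length ns = Suc m" "sorted_wrt (<) ns" "\<forall>n\<in>set ns. Suc 0 \<le> n"
    then obtain xs N where "ns = xs @ [N]"
      by (cases ns rule: rev_cases) auto
    with ns show "Suc 0 \<le> last ns \<and> butlast ns \<in> increasing_lists m {Suc 0..<last ns}"
      by (auto simp: increasing_lists_def sorted_wrt_append)
  qed
  show "\<forall>ns\<in>index_tuples (Suc m). (case (last ns, butlast ns) of (N, xs) \<Rightarrow> xs @ [N]) = ns"
  proof
    fix ns assume "ns \<in> index_tuples (Suc m)"
    then have "ns \<noteq> []" by (auto simp: index_tuples_def)
    then show "(case (last ns, butlast ns) of (N, xs) \<Rightarrow> xs @ [N]) = ns" by simp
  qed
qed (auto simp: index_tuples_def increasing_lists_def sorted_wrt_append subset_iff)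

text \<open>The two variables of positive exponent sit at position \<open>k\<close> and at the end.
  Fixing them leaves two independent blocks, in intervals of sizes \<open>M - 1\<close> and
  \<open>N - M - 1\<close>.\<close>

lemma bij_betw_index_tuples_2:
  "bij_betw (\<lambda>((M, N), xs, ys). xs @ M # ys @ [N])
    (SIGMA (M, N):{(M, N). 1 \<le> M \<and> M < N}.
      increasing_lists k {1..<M} \<times> increasing_lists i {M<..<N})
    (index_tuples (Suc (Suc (k + i))))"
proof (rule bij_betw_byWitness[where f' =
      "\<lambda>ns. ((ns ! k, last ns), take k ns, butlast (drop (Suc k) ns))"], goal_cases)
  \<comment> \<open>The goals are, in order, the two inverse laws and the two inclusions of
    images.\<close>
  case 1
  then show ?case
    by (auto simp: increasing_lists_def nth_append)
next
  case 2
  show ?case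
  proof
    fix ns assume "ns \<in> index_tuples (Suc (Suc (k + i)))"
    then have len: "length ns = Suc (Suc (k + i))" by (simp add: index_tuples_def)
    then have "drop (Suc k) ns \<noteq> []" by simp
    then have "butlast (drop (Suc k) ns) @ [last ns] = drop (Suc k) ns"
      by (metis append_butlast_last_id last_drop drop_eq_Nil not_le)
    then show "(\<lambda>((M, N), xs, ys). xs @ M # ys @ [N])
        ((ns ! k, last ns), take k ns, butlast (drop (Suc k) ns)) = ns"
      using len by (simp add: id_take_nth_drop[symmetric])
  qed
next
  case 3
  show ?case
    by (fastforce simp: index_tuples_def increasing_lists_def sorted_wrt_append subset_iff)
next
  case 4
  show ?case
  proof (rule image_subsetI)
    fix ns assume "ns \<in> index_tuples (Suc (Suc (k + i)))"
    then have ns: "length ns = Suc (Suc (k + i))" "sorted_wrt (<) ns" "\<forall>n\<in>set ns. 1 \<le> n"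
      by (auto simp: index_tuples_def)
    define xs M zs where "xs = take k ns" "M = ns ! k" "zs = drop (Suc k) ns"
    have *: "ns = xs @ M # zs" "length xs = k" "length zs = Suc i"
      using ns id_take_nth_drop[of k ns] by (auto simp: xs_M_zs_def)
    then obtain ys N where "zs = ys @ [N]"
      by (cases zs rule: rev_cases) auto
    with ns * show "((ns ! k, last ns), take k ns, butlast (drop (Suc k) ns)) \<in>
        (SIGMA (M, N):{(M, N). 1 \<le> M \<and> M < N}.
          increasing_lists k {1..<M} \<times> increasing_lists i {M<..<N})"
      by (auto simp: increasing_lists_def sorted_wrt_append nth_append)
  qed
qed

section \<open>Sums with finite fibres and product series\<close>

text \<open>Since \<open>h\<close> ignores the fibre coordinate, summing over a finite fibre
  multiplies by its cardinality. The weighted series thus controls the norms on all of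
  \<open>Sigma B F\<close>, which justifies iterated summation.\<close>

lemma infsum_Sigma_finite_fibres:
  fixes h :: "'a \<Rightarrow> 'b::{banach, real_normed_div_algebra}"
  assumes fin: "\<And>x. x \<in> B \<Longrightarrow> finite (F x)"
    and summ: "(\<lambda>x. of_nat (card (F x)) * h x) abs_summable_on B"
  shows "(\<Sum>\<^sub>\<infinity>(x, y)\<in>Sigma B F. h x) = (\<Sum>\<^sub>\<infinity>x\<in>B. of_nat (card (F x)) * h x)"
proof -
  have "(\<lambda>p. h (fst p)) abs_summable_on Sigma B F"
    unfolding abs_summable_on_Sigma_iff
  proof (intro conjI ballI)
    show "(\<lambda>y. h (fst (x, y))) abs_summable_on F x" if "x \<in> B" for x
      using fin[OF that] by simp
    show "(\<lambda>x. \<Sum>\<^sub>\<infinity>y\<in>F x. norm (h (fst (x, y)))) abs_summable_on B"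
    proof (rule abs_summable_on_comparison_test[OF summ])
      fix x assume "x \<in> B"
      then show "norm (\<Sum>\<^sub>\<infinity>y\<in>F x. norm (h (fst (x, y)))) \<le> norm (of_nat (card (F x)) * h x)"
        using fin by (simp add: norm_mult)
    qed
  qed
  then have "(\<lambda>p. h (fst p)) summable_on Sigma B F"
    by (rule abs_summable_summable)
  from infsum_Sigma_banach[OF this]
  have "(\<Sum>\<^sub>\<infinity>x\<in>B. \<Sum>\<^sub>\<infinity>y\<in>F x. h x) = (\<Sum>\<^sub>\<infinity>p\<in>Sigma B F. h (fst p))" by simp
  moreover have "(\<Sum>\<^sub>\<infinity>x\<in>B. \<Sum>\<^sub>\<infinity>y\<in>F x. h x) = (\<Sum>\<^sub>\<infinity>x\<in>B. of_nat (card (F x)) * h x)"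
    using fin by (intro infsum_cong) simp
  ultimately show ?thesis by (simp add: case_prod_unfold)
qed

text \<open>For fixed \<open>x\<close> the inner sum of norms is \<open>norm (f x)\<close> times a
  constant.\<close>

lemma abs_summable_on_product:
  fixes f :: "'a \<Rightarrow> 'c::{banach, real_normed_div_algebra}"
  assumes "f abs_summable_on A" "g abs_summable_on B"
  shows "(\<lambda>(x, y). f x * g y) abs_summable_on A \<times> B"
  unfolding abs_summable_on_Sigma_iff
proof (intro conjI ballI)
  show "(\<lambda>y. case (x, y) of (x, y) \<Rightarrow> f x * g y) abs_summable_on B" for x
    using assms(2) by (simp add: norm_mult summable_on_cmult_right)
  show "(\<lambda>x. \<Sum>\<^sub>\<infinity>y\<in>B. norm (case (x, y) of (x, y) \<Rightarrow> f x * g y)) abs_summable_on A"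
    using assms(1) by (simp add: norm_mult infsum_cmult_right' abs_mult summable_on_cmult_left)
qed

lemma infsum_product_abs_summable:
  fixes f :: "'a \<Rightarrow> 'c::{banach, real_normed_div_algebra}"
  assumes "f abs_summable_on A" "g abs_summable_on B"
  shows "infsum f A * infsum g B = (\<Sum>\<^sub>\<infinity>(x, y)\<in>A \<times> B. f x * g y)"
proof -
  have "(\<Sum>\<^sub>\<infinity>(x, y)\<in>A \<times> B. f x * g y) = (\<Sum>\<^sub>\<infinity>x\<in>A. \<Sum>\<^sub>\<infinity>y\<in>B. f x * g y)"
    using infsum_Sigma_banach[OF abs_summable_summable[OF abs_summable_on_product[OF assms]]]
    by simp
  then show ?thesis
    by (simp add: infsum_cmult_right' infsum_cmult_left')
qed

text \<open>Root test: the \<open>n\<close>-th root of the term is \<open>root n n ^ k * r\<close>,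
  and \<open>root n n\<close> tends to 1.\<close>

lemma summable_power_mult_geometric:
  fixes r :: real
  assumes "0 \<le> r" "r < 1"
  shows "summable (\<lambda>n. real n ^ k * r ^ n)"
proof (rule root_test_convergence')
  have "(\<lambda>n. root n n ^ k * r) \<longlonglongrightarrow> 1 ^ k * r"
    by (intro tendsto_intros LIMSEQ_root)
  \<comment> \<open>The index 0 is excluded because \<open>root 0\<close> is constantly 0.\<close>
  moreover have "eventually (\<lambda>n. root n (norm (real n ^ k * r ^ n)) = root n n ^ k * r) sequentially"
    using eventually_gt_at_top[of 0]
    by eventually_elim (use assms in \<open>simp add: real_root_mult real_root_power real_root_pos2 abs_mult\<close>)
  ultimately have "(\<lambda>n. root n (norm (real n ^ k * r ^ n))) \<longlonglongrightarrow> r"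
    by (simp add: tendsto_cong)
  then have "(\<lambda>n. ereal (root n (norm (real n ^ k * r ^ n)))) \<longlonglongrightarrow> ereal r"
    by simp
  then have "limsup (\<lambda>n. ereal (root n (norm (real n ^ k * r ^ n)))) = ereal r"
    by (intro lim_imp_Limsup) simp_all
  then show "limsup (\<lambda>n. ereal (root n (norm (real n ^ k * r ^ n)))) < 1"
    using assms by simp
qed

text \<open>Allows the finite sums over coefficients to be exchanged with the infinite sums. For
  infinite \<open>I\<close> both finite sums are 0 by convention.\<close>

lemma has_sum_finite_sum:
  fixes f :: "'i \<Rightarrow> 'a \<Rightarrow> 'b::topological_comm_monoid_add"
  assumes "\<And>i. i \<in> I \<Longrightarrow> (f i has_sum s i) A"
  shows "((\<lambda>x. \<Sum>i\<in>I. f i x) has_sum (\<Sum>i\<in>I. s i)) A"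
  using assms by (induction I rule: infinite_finite_induct) (auto intro: has_sum_add)

section \<open>Multiple q-zeta values of depth one and two\<close>

text \<open>The contribution of a single summation variable \<open>n\<close> with exponent
  \<open>s\<close> to a summand of \<open>zeta_q\<close>.\<close>

definition qpow :: "complex \<Rightarrow> nat \<Rightarrow> nat \<Rightarrow> complex" where
  "qpow q s n = q ^ (n * s) / qnum q n ^ s"

lemma qpow_0: "qpow q 0 n = 1"
  by (simp add: qpow_def)

lemma qpow_add: "qpow q (s + t) n = qpow q s n * qpow q t n"
  by (simp add: qpow_def power_add algebra_simps)

section \<open>Norm estimates and absolute convergence\<close>

text \<open>\<open>qnum q n\<close> is \<open>(1 - q ^ n) / (1 - q)\<close>, where the numerator has
  norm at least \<open>1 - norm q\<close> and the denominator at most 2. The denominators of the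
  series thus stay uniformly away from 0.\<close>

lemma norm_qnum_ge:
  assumes "norm q < 1" "1 \<le> n"
  shows "(1 - norm q) / 2 \<le> norm (qnum q n)"
proof -
  have "qnum q n * (1 - q) = 1 - q ^ n"
    by (simp add: qnum_def one_diff_power_eq mult.commute)
  then have eq: "norm (qnum q n) * norm (1 - q) = norm (1 - q ^ n)"
    by (metis norm_mult)
  have "norm q ^ n \<le> norm q"
    using power_decreasing[of 1 n "norm q"] assms by simp
  then have "1 - norm q \<le> norm (1 - q ^ n)"
    using norm_triangle_ineq2[of 1 "q ^ n"] by (simp add: norm_power)
  also have "\<dots> \<le> norm (qnum q n) * 2"
    unfolding eq[symmetric] using norm_triangle_ineq4[of 1 q] assms by (intro mult_left_mono) auto
  finally show ?thesis by simp
qed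

lemma norm_qpow_le:
  assumes "norm q < 1" "1 \<le> n" "1 \<le> s"
  shows "norm (qpow q s n) \<le> (2 / (1 - norm q)) ^ s * norm q ^ n"
proof -
  have "norm (qpow q s n) = norm q ^ (n * s) * (1 / norm (qnum q n)) ^ s"
    by (simp add: qpow_def norm_divide norm_power power_divide)
  also have "\<dots> \<le> norm q ^ n * (2 / (1 - norm q)) ^ s"
  proof (rule mult_mono)
    show "norm q ^ (n * s) \<le> norm q ^ n"
      using assms by (intro power_decreasing) auto
    have "1 / norm (qnum q n) \<le> 1 / ((1 - norm q) / 2)"
      using norm_qnum_ge[OF assms(1,2)] assms(1) by (intro divide_left_mono mult_pos_pos) auto
    then show "(1 / norm (qnum q n)) ^ s \<le> (2 / (1 - norm q)) ^ s"
      by (intro power_mono) auto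
  qed auto
  finally show ?thesis by (simp add: mult.commute)
qed

text \<open>The binomial grows at most like \<open>N ^ m\<close>, against the geometric decay of
  \<open>qpow\<close>.\<close>

lemma abs_summable_choose_qpow:
  assumes "norm q < 1" "1 \<le> s"
  shows "(\<lambda>N. of_nat ((N - 1) choose m) * qpow q s N) abs_summable_on {1..}"
proof -
  have "summable (\<lambda>n. (2 / (1 - norm q)) ^ s * (real n ^ m * norm q ^ n))"
    using assms by (intro summable_mult summable_power_mult_geometric) auto
  then have "(\<lambda>n. (2 / (1 - norm q)) ^ s * (real n ^ m * norm q ^ n)) summable_on UNIV"
    using assms by (intro norm_summable_imp_summable_on) (simp add: abs_mult power_abs)
  then have "(\<lambda>n. (2 / (1 - norm q)) ^ s * (real n ^ m * norm q ^ n)) summable_on {1..}"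
    by (rule summable_on_subset_banach) simp
  then show ?thesis
  proof (rule abs_summable_on_comparison_test')
    fix N :: nat assume "N \<in> {1..}"
    then have N: "1 \<le> N" by simp
    have "(N - 1) choose m \<le> N ^ m"
    proof (cases "m \<le> N - 1")
      case True
      then have "(N - 1) choose m \<le> (N - 1) ^ m" by (rule binomial_le_pow)
      also have "\<dots> \<le> N ^ m" by (intro power_mono) auto
      finally show ?thesis .
    qed (simp add: binomial_eq_0)
    then have "real ((N - 1) choose m) \<le> real N ^ m"
      by (metis of_nat_le_iff of_nat_power)
    then have "real ((N - 1) choose m) * norm (qpow q s N)
        \<le> real N ^ m * ((2 / (1 - norm q)) ^ s * norm q ^ N)"
      using norm_qpow_le[OF assms(1) N assms(2)] by (intro mult_mono) auto
    then show "norm (of_nat ((N - 1) choose m) * qpow q s N)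
        \<le> (2 / (1 - norm q)) ^ s * (real N ^ m * norm q ^ N)"
      by (simp add: norm_mult mult_ac)
  qed
qed

text \<open>Enlarging \<open>N - M - 1\<close> to \<open>N - 1\<close> in the second binomial
  decouples the variables; a product of two depth-one families, restricted to \<open>M < N\<close>,
  then dominates.\<close>

lemma abs_summable_choose_qpow_2:
  assumes "norm q < 1" "1 \<le> s" "1 \<le> t"
  shows "(\<lambda>(M, N). of_nat (((M - 1) choose k) * ((N - M - 1) choose i)) * (qpow q t M * qpow q s N))
    abs_summable_on {(M, N). 1 \<le> M \<and> M < N}"
proof (rule abs_summable_on_comparison_test)
  show "(\<lambda>(M, N). (of_nat ((M - 1) choose k) * qpow q t M) * (of_nat ((N - 1) choose i) * qpow q s N))
      abs_summable_on {(M, N). 1 \<le> M \<and> M < N}"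
    by (rule summable_on_subset_banach[OF abs_summable_on_product[OF
          abs_summable_choose_qpow[OF assms(1,3)] abs_summable_choose_qpow[OF assms(1,2)]]]) auto
next
  fix p :: "nat \<times> nat" assume "p \<in> {(M, N). 1 \<le> M \<and> M < N}"
  then obtain M N where p: "p = (M, N)" "1 \<le> M" "M < N" by auto
  have "(N - M - 1) choose i \<le> (N - 1) choose i"
    by (rule binomial_right_mono) simp
  then have "real (((M - 1) choose k) * ((N - M - 1) choose i)) * norm (qpow q t M * qpow q s N)
      \<le> real (((M - 1) choose k) * ((N - 1) choose i)) * norm (qpow q t M * qpow q s N)"
    by (intro mult_right_mono) (auto simp del: of_nat_mult)
  then show "norm (case p of (M, N) \<Rightarrow>
        of_nat (((M - 1) choose k) * ((N - M - 1) choose i)) * (qpow q t M * qpow q s N))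
      \<le> norm (case p of (M, N) \<Rightarrow>
        (of_nat ((M - 1) choose k) * qpow q t M) * (of_nat ((N - 1) choose i) * qpow q s N))"
    by (simp add: p norm_mult mult_ac)
qed

section \<open>Multiple series as sums over the variables of positive exponent\<close>

text \<open>A product over a list splits along concatenation, so blocks of zero exponents can be
  separated from the other variables.\<close>

lemma zeta_q_term:
  assumes "length ns = length \<alpha>"
  shows "q ^ (\<Sum>j<length \<alpha>. ns ! j * \<alpha> ! j) / (\<Prod>j<length \<alpha>. qnum q (ns ! j) ^ (\<alpha> ! j))
    = prod_list (map2 (qpow q) \<alpha> ns)"
proof -
  have "prod_list (map2 (qpow q) \<alpha> ns) = (\<Prod>j<length \<alpha>. qpow q (\<alpha> ! j) (ns ! j))"
    using assms by (simp add: prod.list_conv_set_nth atLeast0LessThan)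
  then show ?thesis
    by (simp add: qpow_def prod_dividef power_sum)
qed

lemma prod_list_map2_qpow_zeros:
  "length xs = k \<Longrightarrow> prod_list (map2 (qpow q) (replicate k 0) xs) = 1"
  by (induction xs arbitrary: k) (auto simp: qpow_0)

lemma zeta_q_ind_1:
  assumes "norm q < 1" "1 \<le> a"
  shows "zeta_q_ind q [a] [m] = (\<Sum>\<^sub>\<infinity>N\<in>{1..}. of_nat ((N - 1) choose m) * qpow q a N)"
proof -
  let ?F = "\<lambda>N::nat. increasing_lists m {1..<N}"
  have "zeta_q_ind q [a] [m] = (\<Sum>\<^sub>\<infinity>ns\<in>index_tuples (Suc m).
      prod_list (map2 (qpow q) (replicate m 0 @ [a]) ns))"
    unfolding zeta_q_ind_def zeta_q_def
    \<comment> \<open>The index sets agree only after computing the length of the exponent list,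
      hence a congruence rule that admits different sets.\<close>
    by (rule infsum_cong_neutral) (auto simp: index_tuples_def zeta_q_term[symmetric])
  also have "\<dots> = (\<Sum>\<^sub>\<infinity>p\<in>Sigma {1..} ?F.
      prod_list (map2 (qpow q) (replicate m 0 @ [a]) (case p of (N, xs) \<Rightarrow> xs @ [N])))"
    by (rule infsum_reindex_bij_betw[OF bij_betw_index_tuples_1, symmetric])
  \<comment> \<open>All entries of \<open>xs\<close> carry exponent 0 and contribute 1, so the term
    is constant on each fibre.\<close>
  also have "\<dots> = (\<Sum>\<^sub>\<infinity>(N, xs)\<in>Sigma {1..} ?F. qpow q a N)"
    by (rule infsum_cong) (auto simp: increasing_lists_def prod_list_map2_qpow_zeros)
  also have "\<dots> = (\<Sum>\<^sub>\<infinity>N\<in>{1..}. of_nat (card (?F N)) * qpow q a N)"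
    using abs_summable_choose_qpow[OF assms, of m]
    by (intro infsum_Sigma_finite_fibres) (auto simp: finite_increasing_lists card_increasing_lists)
  finally show ?thesis by (simp add: card_increasing_lists)
qed

text \<open>The depth-one argument with pairs \<open>(M, N)\<close> as base points; each fibre is a
  product of two blocks.\<close>

lemma zeta_q_ind_2:
  assumes "norm q < 1" "1 \<le> a" "1 \<le> b"
  shows "zeta_q_ind q [b, a] [k, i] = (\<Sum>\<^sub>\<infinity>(M, N)\<in>{(M, N). 1 \<le> M \<and> M < N}.
    of_nat (((M - 1) choose k) * ((N - M - 1) choose i)) * (qpow q b M * qpow q a N))"
proof -
  let ?B = "{(M::nat, N). 1 \<le> M \<and> M < N}"
  let ?F = "\<lambda>(M::nat, N). increasing_lists k {1..<M} \<times> increasing_lists i {M<..<N}"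
  let ?\<alpha> = "replicate k 0 @ b # replicate i 0 @ [a]"
  let ?h = "\<lambda>p. qpow q b (fst p) * qpow q a (snd p)"
  have "zeta_q_ind q [b, a] [k, i] = (\<Sum>\<^sub>\<infinity>ns\<in>index_tuples (Suc (Suc (k + i))).
      prod_list (map2 (qpow q) ?\<alpha> ns))"
    unfolding zeta_q_ind_def zeta_q_def
    by (rule infsum_cong_neutral) (auto simp: index_tuples_def zeta_q_term[symmetric])
  also have "\<dots> = (\<Sum>\<^sub>\<infinity>p\<in>Sigma ?B ?F.
      prod_list (map2 (qpow q) ?\<alpha> ((\<lambda>((M, N), xs, ys). xs @ M # ys @ [N]) p)))"
    by (rule infsum_reindex_bij_betw[OF bij_betw_index_tuples_2, symmetric])
  also have "\<dots> = (\<Sum>\<^sub>\<infinity>(p, _)\<in>Sigma ?B ?F. ?h p)"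
    by (rule infsum_cong) (auto simp: increasing_lists_def prod_list_map2_qpow_zeros)
  also have "\<dots> = (\<Sum>\<^sub>\<infinity>p\<in>?B. of_nat (card (?F p)) * ?h p)"
    using abs_summable_choose_qpow_2[OF assms, of k i]
    by (intro infsum_Sigma_finite_fibres)
      (auto simp: finite_increasing_lists card_increasing_lists card_cartesian_product
        case_prod_unfold simp del: of_nat_mult)
  finally show ?thesis
    by (simp add: card_increasing_lists card_cartesian_product case_prod_unfold)
qed

section \<open>Expansion of the off-diagonal and diagonal sums\<close>

text \<open>The coefficient is expanded pointwise by \<open>choose_mult_choose_offdiagonal\<close>;
  each of the finitely many terms sums to a depth-two value, and \<open>has_sum\<close> respects
  finite linear combinations.\<close>

lemma infsum_choose_qpow_offdiagonal:
  assumes "norm q < 1" "1 \<le> a" "1 \<le> b"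
  shows "(\<Sum>\<^sub>\<infinity>(M, N)\<in>{(M, N). 1 \<le> M \<and> M < N}.
      (of_nat ((M - 1) choose n) * qpow q b M) * (of_nat ((N - 1) choose m) * qpow q a N))
    = (\<Sum>i = 0..m. \<Sum>k = n..m + n - i.
         of_nat (binom k (int n) * binom (n + 1) (int i + int k - int m + 1))
           * zeta_q_ind q [b, a] [k, i])"
proof -
  let ?B = "{(M::nat, N). 1 \<le> M \<and> M < N}"
  let ?c = "\<lambda>i k. binom k (int n) * binom (n + 1) (int i + int k - int m + 1)"
  let ?g = "\<lambda>i k (M, N). of_nat (((M - 1) choose k) * ((N - M - 1) choose i)) * (qpow q b M * qpow q a N)"
  have summ: "?g i k summable_on ?B" for i k
    by (rule abs_summable_summable[OF abs_summable_choose_qpow_2[OF assms]])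
  have has: "((\<lambda>p. of_nat (?c i k) * ?g i k p) has_sum of_nat (?c i k) * zeta_q_ind q [b, a] [k, i]) ?B"
    for i k
    unfolding zeta_q_ind_2[OF assms] by (intro has_sum_cmult_right has_sum_infsum summ)
  have "((\<lambda>p. \<Sum>i = 0..m. \<Sum>k = n..m + n - i. of_nat (?c i k) * ?g i k p) has_sum
      (\<Sum>i = 0..m. \<Sum>k = n..m + n - i. of_nat (?c i k) * zeta_q_ind q [b, a] [k, i])) ?B"
    by (intro has_sum_finite_sum has)
  moreover have "(\<Sum>i = 0..m. \<Sum>k = n..m + n - i. of_nat (?c i k) * ?g i k (M, N))
     = (of_nat ((M - 1) choose n) * qpow q b M) * (of_nat ((N - 1) choose m) * qpow q a N)"
    if "1 \<le> M" "M < N" for M N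
  proof -
    have "(of_nat ((M - 1) choose n) * qpow q b M) * (of_nat ((N - 1) choose m) * qpow q a N)
        = of_nat (((N - 1) choose m) * ((M - 1) choose n)) * (qpow q b M * qpow q a N)"
      by (simp add: mult_ac)
    also have "\<dots> = (\<Sum>i = 0..m. \<Sum>k = n..m + n - i. of_nat (?c i k) * ?g i k (M, N))"
      unfolding choose_mult_choose_offdiagonal[OF that]
      by (simp add: sum_distrib_left sum_distrib_right mult_ac)
    finally show ?thesis by simp
  qed
  ultimately show ?thesis
    by (subst infsumI[symmetric, where A = ?B]) (assumption, rule infsum_cong, force)
qed

text \<open>At equal indices the two factors merge into exponent \<open>a + b\<close> by
  \<open>qpow_add\<close>, so only depth-one values appear.\<close>

lemma infsum_choose_qpow_diagonal:
  assumes "norm q < 1" "1 \<le> a" "1 \<le> b"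
  shows "(\<Sum>\<^sub>\<infinity>N\<in>{1..}.
      (of_nat ((N - 1) choose n) * qpow q b N) * (of_nat ((N - 1) choose m) * qpow q a N))
    = (\<Sum>k = n..m + n. of_nat (binom k (int n) * binom n (int k - int m)) * zeta_q_ind q [a + b] [k])"
proof -
  let ?c = "\<lambda>k. binom k (int n) * binom n (int k - int m)"
  let ?g = "\<lambda>k N. of_nat ((N - 1) choose k) * qpow q (a + b) N"
  have ab: "1 \<le> a + b" using assms by simp
  have summ: "?g k summable_on {1..}" for k
    by (rule abs_summable_summable[OF abs_summable_choose_qpow[OF assms(1) ab]])
  have has: "((\<lambda>N. of_nat (?c k) * ?g k N) has_sum of_nat (?c k) * zeta_q_ind q [a + b] [k]) {1..}" for k
    unfolding zeta_q_ind_1[OF assms(1) ab]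
    by (intro has_sum_cmult_right has_sum_infsum summ)
  have "((\<lambda>N. \<Sum>k = n..m + n. of_nat (?c k) * ?g k N) has_sum
      (\<Sum>k = n..m + n. of_nat (?c k) * zeta_q_ind q [a + b] [k])) {1..}"
    by (intro has_sum_finite_sum has)
  moreover have "(\<Sum>k = n..m + n. of_nat (?c k) * ?g k N)
     = (of_nat ((N - 1) choose n) * qpow q b N) * (of_nat ((N - 1) choose m) * qpow q a N)" for N
  proof -
    have "(of_nat ((N - 1) choose n) * qpow q b N) * (of_nat ((N - 1) choose m) * qpow q a N)
        = of_nat (((N - 1) choose m) * ((N - 1) choose n)) * qpow q (a + b) N"
      by (simp add: qpow_add mult_ac)
    also have "\<dots> = (\<Sum>k = n..m + n. of_nat (?c k) * ?g k N)"
      unfolding choose_mult_choose_diagonal by (simp add: sum_distrib_right mult.assoc)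
    finally show ?thesis by simp
  qed
  ultimately show ?thesis
    by (simp add: infsumI)
qed

theorem theorem5p7:
  fixes q :: complex and a b m n :: nat
  assumes "norm q < 1" and "a \<ge> m + 2" and "b \<ge> n + 2"
  shows "zeta_q_ind q [a] [m] * zeta_q_ind q [b] [n] =
      (\<Sum>i = 0..m. \<Sum>k = n..m + n - i.
         of_nat (binom k (int n) * binom (n + 1) (int i + int k - int m + 1))
           * zeta_q_ind q [b, a] [k, i])
    + (\<Sum>i = 0..n. \<Sum>k = m..m + n - i.
         of_nat (binom k (int m) * binom (m + 1) (int i + int k - int n + 1))
           * zeta_q_ind q [a, b] [k, i])
    + (\<Sum>k = n..m + n.
         of_nat (binom k (int n) * binom n (int k - int m)) * zeta_q_ind q [a + b] [k])"
proof -
  have a: "1 \<le> a" and b: "1 \<le> b" using assms by auto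
  define u where "u = (\<lambda>N. of_nat ((N - 1) choose m) * qpow q a N)"
  define v where "v = (\<lambda>M. of_nat ((M - 1) choose n) * qpow q b M)"
  \<comment> \<open>The first coordinate \<open>M\<close> carries exponent \<open>b\<close> and the
    second \<open>a\<close>. The smaller variable comes first in \<open>zeta_q\<close>, so
    \<open>?L\<close> gives the values for \<open>[b, a]\<close> and \<open>?U\<close> those for
    \<open>[a, b]\<close>.\<close>
  let ?L = "{(M::nat, N). 1 \<le> M \<and> M < N}"
  let ?U = "{(M::nat, N). 1 \<le> N \<and> N < M}"
  let ?D = "(\<lambda>N::nat. (N, N)) ` {1..}"
  let ?f = "\<lambda>(M, N). v M * u N"
  have u: "u abs_summable_on {1..}" and v: "v abs_summable_on {1..}"
    unfolding u_def v_def using abs_summable_choose_qpow assms(1) a b by blast+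
  \<comment> \<open>Absolute summability on the full product passes to every subset, so the sum may
    be cut into pieces.\<close>
  have summ: "?f summable_on S" if "S \<subseteq> {1..} \<times> {1..}" for S
    using summable_on_subset_banach[OF abs_summable_summable[OF abs_summable_on_product[OF v u]] that] .
  have split: "{1..} \<times> {1..} = (?L \<union> ?U) \<union> ?D"
    by (auto simp: image_iff)
  have "zeta_q_ind q [a] [m] * zeta_q_ind q [b] [n] = infsum v {1..} * infsum u {1..}"
    unfolding zeta_q_ind_1[OF assms(1) a] zeta_q_ind_1[OF assms(1) b] u_def v_def
    by (rule mult.commute)
  also have "\<dots> = infsum ?f ({1..} \<times> {1..})"
    by (rule infsum_product_abs_summable[OF v u])
  also have "\<dots> = infsum ?f (?L \<union> ?U) + infsum ?f ?D"
    unfolding split by (rule infsum_Un_disjoint) (rule summ, force, rule summ, force, auto)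
  also have "infsum ?f (?L \<union> ?U) = infsum ?f ?L + infsum ?f ?U"
    by (rule infsum_Un_disjoint) (rule summ, force, rule summ, force, auto)
  also have "infsum ?f ?L = (\<Sum>i = 0..m. \<Sum>k = n..m + n - i.
         of_nat (binom k (int n) * binom (n + 1) (int i + int k - int m + 1))
           * zeta_q_ind q [b, a] [k, i])"
    unfolding u_def v_def by (rule infsum_choose_qpow_offdiagonal[OF assms(1) a b])
  \<comment> \<open>Swapping coordinates carries \<open>?U\<close> to \<open>?L\<close> with
    \<open>u\<close> at the smaller variable, so the off-diagonal formula applies with
    \<open>(a, m)\<close> and \<open>(b, n)\<close> exchanged.\<close>
  also have "infsum ?f ?U = (\<Sum>\<^sub>\<infinity>(N, M)\<in>?L. u N * v M)"
    by (rule infsum_reindex_bij_witness[of _ prod.swap prod.swap]) (auto simp: mult.commute)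
  also have "\<dots> = (\<Sum>i = 0..n. \<Sum>k = m..m + n - i.
         of_nat (binom k (int m) * binom (m + 1) (int i + int k - int n + 1))
           * zeta_q_ind q [a, b] [k, i])"
    using infsum_choose_qpow_offdiagonal[OF assms(1) b a, of m n]
    unfolding u_def v_def by (simp add: add.commute)
  also have "infsum ?f ?D = (\<Sum>\<^sub>\<infinity>N\<in>{1..}. v N * u N)"
    by (subst infsum_reindex) (auto simp: inj_on_def o_def)
  also have "\<dots> = (\<Sum>k = n..m + n.
         of_nat (binom k (int n) * binom n (int k - int m)) * zeta_q_ind q [a + b] [k])"
    unfolding u_def v_def by (rule infsum_choose_qpow_diagonal[OF assms(1) a b])
  finally show ?thesis .
qed

end
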